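(* Let $G=C_2^3\times C_3$ with generators $u,v,w,z$ of orders $2,2,2,3$. For an odd integer $D$, $D\in S(G)$ if and only if $D\equiv1\pmod8$ and $\mathsf T(D)$ holds. Every such determinant is the determinant of an element of $\mathbb Z[G]$ of the form $$1+(1+u)(1+v)(1+w)(r+sz+tz^2),\qquad r,s,t\in\mathbb Z.$$
   Context: For a finite group $G$, the determinant of $\sum a_gg\in\mathbb Z[G]$ is $\det(a_{gh^{-1}})_{g,h\in G}$, and $S(G)$ is the set of all such determinants. The group $C_2^3\times C_3$ is isomorphic to $C_2\times C_2\times C_6$. $O=\mathbb Z[\omega]$ with $\omega^2+\omega+1=0$, $\lambda=1-\omega$, $N(b+c\omega)=b^2-bc+c^2$. For a nonzero signed odd integer $t$, $\mathsf T(t)$ is the condition that there exist an odd $A\in\mathbb Z$ and $\beta\in O$ with $t=A\,N(\beta)$, $\beta\equiv1\pmod{8O}$ and $A\equiv\beta\pmod{\lambda O}$. *)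

theory Defs
  imports "HOL-Analysis.Analysis" "HOL-Library.Poly_Mapping" "HOL-Number_Theory.Cong"
begin

text \<open>
  A finite group is a type \<open>'g\<close> of class \<open>{finite, group_add}\<close>, written additively, so that
  \<open>g h\<^sup>-\<^sup>1\<close> becomes \<open>g - h\<close>. Its integral group ring is the convolution ring \<open>'g \<Rightarrow>\<^sub>0 int\<close>,
  in which the group element \<open>g\<close> is \<open>Poly_Mapping.single g 1\<close>.
\<close>

definition group_det :: "('g::{finite, group_add} \<Rightarrow>\<^sub>0 int) \<Rightarrow> int"
  where "group_det a = det (\<chi> g h. Poly_Mapping.lookup a (g - h))"

definition group_dets :: "'g::{finite, group_add} itself \<Rightarrow> int set"
  where "group_dets _ = range (group_det :: ('g \<Rightarrow>\<^sub>0 int) \<Rightarrow> int)"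

text \<open>The numeral types \<open>2\<close> and \<open>3\<close> are the additive groups of integers modulo 2 and 3.\<close>

type_synonym C222C3 = "2 \<times> 2 \<times> 2 \<times> 3"

definition gen_u :: "C222C3 \<Rightarrow>\<^sub>0 int" where "gen_u = Poly_Mapping.single (1, 0, 0, 0) 1"
definition gen_v :: "C222C3 \<Rightarrow>\<^sub>0 int" where "gen_v = Poly_Mapping.single (0, 1, 0, 0) 1"
definition gen_w :: "C222C3 \<Rightarrow>\<^sub>0 int" where "gen_w = Poly_Mapping.single (0, 0, 1, 0) 1"
definition gen_z :: "C222C3 \<Rightarrow>\<^sub>0 int" where "gen_z = Poly_Mapping.single (0, 0, 0, 1) 1"

definition eis_omega :: complex
  where "eis_omega = cis (2 * pi / 3)"

lemma eis_omega_alt: "eis_omega = Complex (- 1 / 2) (sqrt 3 / 2)"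
  by (simp add: eis_omega_def complex_eq_iff cos_120 sin_120)

lemma eis_omega_root: "eis_omega\<^sup>2 + eis_omega + 1 = 0"
  by (simp add: eis_omega_alt complex_eq_iff power2_eq_square)

definition eisenstein_ints :: "complex set"
  where "eisenstein_ints = {of_int b + of_int c * eis_omega | b c. True}"

definition eis_norm :: "complex \<Rightarrow> int"
  where "eis_norm \<beta> =
    (THE n. \<exists>b c. \<beta> = of_int b + of_int c * eis_omega \<and> n = b\<^sup>2 - b * c + c\<^sup>2)"

lemma eis_coords_unique:
  assumes "of_int b + of_int c * eis_omega = of_int b' + of_int c' * eis_omega"
  shows "b = b'" and "c = c'"
  using assms by (auto simp: eis_omega_alt complex_eq_iff)

lemma eis_norm_eq: "eis_norm (of_int b + of_int c * eis_omega) = b\<^sup>2 - b * c + c\<^sup>2"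
  unfolding eis_norm_def by (rule the_equality) (auto dest: eis_coords_unique)

definition eis_cong :: "complex \<Rightarrow> complex \<Rightarrow> complex \<Rightarrow> bool"
  where "eis_cong m x y \<longleftrightarrow> (\<exists>\<gamma>\<in>eisenstein_ints. x - y = m * \<gamma>)"

definition eis_lambda :: complex
  where "eis_lambda = 1 - eis_omega"

text \<open>Meant for odd, hence nonzero, \<open>t\<close> of either sign.\<close>

definition cond_T :: "int \<Rightarrow> bool"
  where "cond_T t \<longleftrightarrow>
    (\<exists>A. \<exists>\<beta>\<in>eisenstein_ints. odd A \<and> t = A * eis_norm \<beta> \<and>
       eis_cong 8 \<beta> 1 \<and> eis_cong eis_lambda (of_int A) \<beta>)"

end

theory Submission
  imports Defs
begin

text \<open>
  A group determinant is the product of the values of the element at all characters. For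
  \<open>G = C\<^sub>2\<^sup>3 \<times> C\<^sub>3\<close> it is therefore \<open>A N(B)\<close>, where \<open>A\<close> and \<open>B\<close> are the products of the
  eight values at the characters that are trivial on \<open>C\<^sub>3\<close>, respectively that map \<open>z\<close> to \<open>\<omega>\<close>;
  clearly \<open>A \<equiv> B\<close> modulo \<open>\<lambda>\<close>. Such a product of eight values is congruent modulo 8 to the eighth
  power of the value at the trivial character of \<open>C\<^sub>2\<^sup>3\<close>. An odd integer has eighth power 1 modulo 8,
  while an element of \<open>O\<close> prime to 2 is a power of \<open>\<omega>\<close> modulo 2, so its eighth power is a
  power of \<open>\<omega>\<close> modulo 8; multiplying \<open>B\<close> by a suitable \<open>\<omega>\<^sup>j\<close> gives \<open>\<beta>\<close>.

  Conversely, on an element of the special form only the three characters trivial on \<open>C\<^sub>2\<^sup>3\<close>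
  contribute, and the determinant is \<open>(1 + 8 (r + s + t)) N(1 + 8 (r + s \<omega> + t \<omega>\<^sup>2))\<close>. Solving
  for \<open>r, s, t\<close> requires exactly the divisibility by 3 encoded in \<open>A \<equiv> \<beta>\<close> modulo \<open>\<lambda>\<close>.
\<close>

section \<open>Group determinants as products of character values\<close>

lemma det_of_int: "det (\<chi> i j. (of_int (A $ i $ j) :: 'a::comm_ring_1)) = of_int (det (A :: int^'n^'n))"
  by (simp add: det_def)

text \<open>The linear extension of \<open>ch\<close> to the group ring; for a homomorphism
  \<open>ch\<close> it is a ring homomorphism into the complex numbers.\<close>

definition char_sum :: "('g::finite \<Rightarrow> complex) \<Rightarrow> ('g \<Rightarrow>\<^sub>0 int) \<Rightarrow> complex"
  where "char_sum ch a = (\<Sum>g\<in>UNIV. of_int (Poly_Mapping.lookup a g) * ch g)"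

lemma char_sum_add: "char_sum ch (a + b) = char_sum ch a + char_sum ch b"
  by (simp add: char_sum_def lookup_add algebra_simps sum.distrib)

lemma char_sum_single: "char_sum ch (Poly_Mapping.single g n) = of_int n * ch g"
proof -
  have "char_sum ch (Poly_Mapping.single g n) = (\<Sum>h\<in>UNIV. if g = h then of_int n * ch g else 0)"
    unfolding char_sum_def by (intro sum.cong) (auto simp: lookup_single when_def)
  then show ?thesis by simp
qed

lemma char_sum_of_int:
  fixes ch :: "'g::{finite, monoid_add} \<Rightarrow> complex"
  assumes "ch 0 = 1"
  shows "char_sum ch (of_int n) = of_int n" and "char_sum ch 1 = 1"
proof -
  have "(of_int n :: 'g \<Rightarrow>\<^sub>0 int) = Poly_Mapping.single 0 n"
    by (metis of_int_eq_id id_apply single_of_int)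
  then show "char_sum ch (of_int n) = of_int n"
    using assms char_sum_single by (metis mult.right_neutral)
  show "char_sum ch 1 = 1"
    using assms char_sum_single[of ch 0 1] by simp
qed

text \<open>For given \<open>k\<close> and \<open>l\<close> the only partner in the convolution is
  \<open>- l + k\<close>; the order matters because the group need not be commutative.\<close>

lemma lookup_times_group:
  fixes a b :: "'g::{finite, group_add} \<Rightarrow>\<^sub>0 int"
  shows "Poly_Mapping.lookup (a * b) k =
    (\<Sum>l\<in>UNIV. Poly_Mapping.lookup a l * Poly_Mapping.lookup b (- l + k))"
proof -
  have *: "(k = l + q) = (- l + k = q)" for l q :: 'g
    by (metis add.assoc add.left_inverse add.right_inverse add_0)
  have "Sum_any f = sum f UNIV" for f :: "'g \<Rightarrow> int"
    by (simp add: Sum_any.expand_superset)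
  then show ?thesis
    by (simp add: times_poly_mapping.rep_eq prod_fun_def * when_def)
qed

lemma char_sum_mult:
  fixes a b :: "'g::{finite, group_add} \<Rightarrow>\<^sub>0 int"
  assumes hom: "\<And>g h. ch (g + h) = ch g * ch h"
  shows "char_sum ch (a * b) = char_sum ch a * char_sum ch b"
proof -
  let ?a = "\<lambda>g. of_int (Poly_Mapping.lookup a g) :: complex"
  let ?b = "\<lambda>g. of_int (Poly_Mapping.lookup b g) :: complex"
  have "char_sum ch (a * b) = (\<Sum>k\<in>UNIV. \<Sum>l\<in>UNIV. ?a l * ?b (- l + k) * ch k)"
    by (simp add: char_sum_def lookup_times_group sum_distrib_right)
  also have "\<dots> = (\<Sum>l\<in>UNIV. \<Sum>k\<in>UNIV. ?a l * ?b (- l + k) * ch k)"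
    by (rule sum.swap)
  \<comment> \<open>Left translation by \<open>l\<close> permutes the group; afterwards
    \<open>hom\<close> splits \<open>ch (l + k)\<close> and the double sum factors.\<close>
  also have "\<dots> = (\<Sum>l\<in>UNIV. \<Sum>k\<in>UNIV. ?a l * ?b k * ch (l + k))"
  proof (rule sum.cong[OF refl])
    fix l :: 'g
    show "(\<Sum>k\<in>UNIV. ?a l * ?b (- l + k) * ch k) = (\<Sum>k\<in>UNIV. ?a l * ?b k * ch (l + k))"
      by (rule sum.reindex_bij_witness[where i = "\<lambda>k. l + k" and j = "\<lambda>k. - l + k"])
        (auto simp: add.assoc[symmetric])
  qed
  also have "\<dots> = char_sum ch a * char_sum ch b"
    by (simp add: char_sum_def hom sum_product mult_ac)
  finally show ?thesis .
qed

text \<open>The character table \<open>X\<close> diagonalises the group matrix \<open>M\<close>: \<open>X M = D X\<close> with \<open>D\<close> diagonal.\<close>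

lemma group_det_char:
  fixes a :: "'g::{finite, group_add} \<Rightarrow>\<^sub>0 int"
  assumes hom: "\<And>k g h. ch k (g + h) = ch k g * ch k h"
    and det: "det (\<chi> k g. ch k g) \<noteq> 0"
  shows "of_int (group_det a) = (\<Prod>k\<in>UNIV. char_sum (ch k) a)"
proof -
  let ?a = "\<lambda>g. of_int (Poly_Mapping.lookup a g) :: complex"
  let ?M = "(\<chi> g h. ?a (g - h)) :: complex^_^_"
  let ?X = "(\<chi> k g. ch k g) :: complex^_^_"
  let ?D = "(\<chi> k l. if k = l then char_sum (ch k) a else 0) :: complex^_^_"
  have M: "of_int (group_det a) = det ?M"
    unfolding group_det_def det_of_int[symmetric] by simp
  have "(\<Sum>g\<in>UNIV. ch k g * ?a (g - h)) = char_sum (ch k) a * ch k h" for k h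
  proof -
    have "(\<Sum>g\<in>UNIV. ch k g * ?a (g - h)) = (\<Sum>g\<in>UNIV. ch k (g + h) * ?a g)"
      by (rule sum.reindex_bij_witness[where i = "\<lambda>g. g + h" and j = "\<lambda>g. g - h"]) auto
    then show ?thesis
      by (simp add: char_sum_def hom sum_distrib_left mult_ac)
  qed
  then have "(\<Sum>g\<in>UNIV. ch k g * ?a (g - h)) =
      (\<Sum>l\<in>UNIV. (if k = l then char_sum (ch k) a else 0) * ch l h)" for k h
    by (simp add: if_distrib[where f = "\<lambda>x. x * y" for y] cong: if_cong)
  then have "?X ** ?M = ?D ** ?X"
    unfolding matrix_matrix_mult_def by (simp only: vec_lambda_beta)
  then have "det ?X * det ?M = det ?D * det ?X"
    by (simp only: det_mul[symmetric])
  moreover have "det ?D = (\<Prod>k\<in>UNIV. char_sum (ch k) a)"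
    by (subst det_diagonal) auto
  ultimately show ?thesis
    unfolding M using det by (simp add: mult.commute[of "det ?X"])
qed

section \<open>The ring of Eisenstein integers\<close>

lemma omega_sq: "eis_omega\<^sup>2 = - 1 - eis_omega"
  using eis_omega_root by (simp add: eq_diff_eq eq_neg_iff_add_eq_0)

lemma omega_mult: "eis_omega * eis_omega = - 1 - eis_omega"
  using omega_sq by (simp add: power2_eq_square)

lemma omega_cube: "eis_omega * eis_omega\<^sup>2 = 1"
  unfolding omega_sq by (simp add: right_diff_distrib omega_mult)

lemma cnj_omega: "cnj eis_omega = eis_omega\<^sup>2"
  unfolding omega_sq by (simp add: eis_omega_alt complex_eq_iff)

lemma omega_simps:
  "eis_omega * eis_omega = eis_omega\<^sup>2" "eis_omega * eis_omega\<^sup>2 = 1"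
  "eis_omega\<^sup>2 * eis_omega = 1" "eis_omega\<^sup>2 * eis_omega\<^sup>2 = eis_omega"
  "eis_omega ^ 4 = eis_omega" "cnj eis_omega = eis_omega\<^sup>2" "cnj (eis_omega\<^sup>2) = eis_omega"
proof -
  show 1: "eis_omega * eis_omega = eis_omega\<^sup>2"
    by (simp add: power2_eq_square)
  show 2: "eis_omega * eis_omega\<^sup>2 = 1"
    by (rule omega_cube)
  show 3: "eis_omega\<^sup>2 * eis_omega = 1"
    using omega_cube by (simp only: mult.commute)
  show 4: "eis_omega\<^sup>2 * eis_omega\<^sup>2 = eis_omega"
    by (metis 1 2 mult.assoc mult.right_neutral)
  then show "eis_omega ^ 4 = eis_omega"
    by (simp flip: power_add)
  show "cnj eis_omega = eis_omega\<^sup>2"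
    by (rule cnj_omega)
  show "cnj (eis_omega\<^sup>2) = eis_omega"
    using 4 by (metis cnj_omega complex_cnj_cnj)
qed

lemma eis_intsI [intro]: "of_int b + of_int c * eis_omega \<in> eisenstein_ints"
  by (auto simp: eisenstein_ints_def)

lemma eis_intsE:
  assumes "x \<in> eisenstein_ints"
  obtains b c where "x = of_int b + of_int c * eis_omega"
  using assms by (auto simp: eisenstein_ints_def)

lemma eis_ints_of_int [simp]: "of_int b \<in> eisenstein_ints"
  using eis_intsI[of b 0] by simp

lemma eis_ints_consts [simp]:
  "0 \<in> eisenstein_ints" "1 \<in> eisenstein_ints" "numeral n \<in> eisenstein_ints"
  using eis_ints_of_int[of 0] eis_ints_of_int[of 1] eis_ints_of_int[of "numeral n"] by simp_all

lemma eis_ints_omega [simp]: "eis_omega \<in> eisenstein_ints"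
  using eis_intsI[of 0 1] by simp

lemma eis_ints_add [simp]:
  assumes "x \<in> eisenstein_ints" "y \<in> eisenstein_ints"
  shows "x + y \<in> eisenstein_ints"
proof -
  obtain b c b' c' where "x = of_int b + of_int c * eis_omega" "y = of_int b' + of_int c' * eis_omega"
    using assms by (metis eis_intsE)
  then have "x + y = of_int (b + b') + of_int (c + c') * eis_omega"
    by (simp add: algebra_simps)
  then show ?thesis by (simp only: eis_intsI)
qed

lemma eis_mult_coords:
  "(of_int b + of_int c * eis_omega) * (of_int b' + of_int c' * eis_omega) =
    of_int (b * b' - c * c') + of_int (b * c' + c * b' - c * c') * eis_omega"
proof -
  have "(of_int b + of_int c * eis_omega) * (of_int b' + of_int c' * eis_omega) =
    of_int (b * b') + of_int (b * c' + c * b') * eis_omega + of_int (c * c') * eis_omega\<^sup>2"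
    by (simp add: algebra_simps power2_eq_square)
  then show ?thesis
    by (simp add: omega_sq algebra_simps)
qed

lemma eis_ints_mult [simp]:
  assumes "x \<in> eisenstein_ints" "y \<in> eisenstein_ints"
  shows "x * y \<in> eisenstein_ints"
  using assms by (metis eis_intsE eis_mult_coords eis_intsI)

lemma eis_ints_uminus [simp]: "x \<in> eisenstein_ints \<Longrightarrow> - x \<in> eisenstein_ints"
  using eis_ints_mult[OF eis_ints_of_int[of "- 1"], of x] by simp

lemma eis_ints_diff [simp]:
  "x \<in> eisenstein_ints \<Longrightarrow> y \<in> eisenstein_ints \<Longrightarrow> x - y \<in> eisenstein_ints"
  using eis_ints_add[of x "- y"] by simp

lemma eis_ints_power [simp]: "x \<in> eisenstein_ints \<Longrightarrow> x ^ n \<in> eisenstein_ints"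
  by (induction n) simp_all

lemma eis_ints_sum [simp]: "(\<And>i. i \<in> I \<Longrightarrow> f i \<in> eisenstein_ints) \<Longrightarrow> sum f I \<in> eisenstein_ints"
  by (induction I rule: infinite_finite_induct) simp_all

lemma eis_ints_prod [simp]: "(\<And>i. i \<in> I \<Longrightarrow> f i \<in> eisenstein_ints) \<Longrightarrow> prod f I \<in> eisenstein_ints"
  by (induction I rule: infinite_finite_induct) simp_all

text \<open>Makes the norm computable without coordinates: conjugation sends \<omega> to \<omega>^2,
  and \<omega> + \<omega>^2 = -1 produces the term \<open>- b * c\<close>.\<close>

lemma eis_norm_eq_mult_cnj:
  assumes "x \<in> eisenstein_ints"
  shows "of_int (eis_norm x) = x * cnj x"
proof -
  obtain b c where x: "x = of_int b + of_int c * eis_omega"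
    using assms by (rule eis_intsE)
  have "x * cnj x = of_int b ^ 2 + of_int b * of_int c * (eis_omega + eis_omega\<^sup>2) +
      of_int c ^ 2 * (eis_omega * eis_omega\<^sup>2)"
    by (simp add: x cnj_omega power2_eq_square algebra_simps)
  then show ?thesis
    unfolding x eis_norm_eq omega_cube by (simp add: omega_sq)
qed

section \<open>Congruences between Eisenstein integers\<close>

lemma eis_congI: "x = y + m * c \<Longrightarrow> c \<in> eisenstein_ints \<Longrightarrow> eis_cong m x y"
  by (auto simp: eis_cong_def)

lemma eis_congE:
  assumes "eis_cong m x y"
  obtains c where "c \<in> eisenstein_ints" "x = y + m * c"
  using assms by (auto simp: eis_cong_def algebra_simps)

lemma eis_cong_refl [simp]: "eis_cong m x x"
  by (rule eis_congI[where c = 0]) simp_all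

lemma eis_cong_trans:
  assumes "eis_cong m x y" "eis_cong m y z"
  shows "eis_cong m x z"
proof -
  obtain c d where *: "c \<in> eisenstein_ints" "x = y + m * c" "d \<in> eisenstein_ints" "y = z + m * d"
    using assms by (metis eis_congE)
  show ?thesis
    by (rule eis_congI[where c = "c + d"]) (use * in \<open>simp_all add: algebra_simps\<close>)
qed

lemma eis_cong_add:
  assumes "eis_cong m x y" "eis_cong m x' y'"
  shows "eis_cong m (x + x') (y + y')"
proof -
  obtain c d where *: "c \<in> eisenstein_ints" "x = y + m * c" "d \<in> eisenstein_ints" "x' = y' + m * d"
    using assms by (metis eis_congE)
  show ?thesis
    by (rule eis_congI[where c = "c + d"]) (use * in \<open>simp_all add: algebra_simps\<close>)
qed

lemma eis_cong_mult:
  assumes "eis_cong m x y" "eis_cong m x' y'" "x \<in> eisenstein_ints" "y' \<in> eisenstein_ints"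
  shows "eis_cong m (x * x') (y * y')"
proof -
  obtain c d where *: "c \<in> eisenstein_ints" "x = y + m * c" "d \<in> eisenstein_ints" "x' = y' + m * d"
    using assms by (metis eis_congE)
  show ?thesis
  proof (rule eis_congI)
    show "x * x' = y * y' + m * (x * d + c * y')"
      by (simp add: *(2,4) algebra_simps)
    show "x * d + c * y' \<in> eisenstein_ints"
      by (simp add: assms(3,4) *(1,3))
  qed
qed

lemma eis_cong_power:
  assumes "eis_cong m x y" "x \<in> eisenstein_ints" "y \<in> eisenstein_ints"
  shows "eis_cong m (x ^ n) (y ^ n)"
  by (induction n) (simp_all add: assms eis_cong_mult)

lemma eis_cong_prod:
  assumes "\<And>i. eis_cong m (f i) (g i)" "\<And>i. f i \<in> eisenstein_ints" "\<And>i. g i \<in> eisenstein_ints"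
  shows "eis_cong m (prod f I) (prod g I)"
  by (induction I rule: infinite_finite_induct) (simp_all add: assms eis_cong_mult)

lemma eis_cong_sum:
  assumes "\<And>i. eis_cong m (f i) (g i)"
  shows "eis_cong m (sum f I) (sum g I)"
  by (induction I rule: infinite_finite_induct) (simp_all add: assms eis_cong_add)

lemma eis_cong_of_int:
  assumes "eis_cong (of_int m) (of_int a) (of_int b)"
  shows "[a = b] (mod m)"
proof -
  obtain x y where "of_int a = of_int b + of_int m * (of_int x + of_int y * eis_omega)"
    using assms by (metis eis_congE eis_intsE)
  then have "of_int a + of_int 0 * eis_omega = of_int (b + m * x) + of_int (m * y) * eis_omega"
    by (simp add: algebra_simps)
  then have "a = b + m * x"
    by (rule eis_coords_unique)
  then show ?thesis
    by (simp add: cong_iff_dvd_diff)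
qed

section \<open>Products of character values modulo 8\<close>

text \<open>The increments \<open>2 * a\<close>, \<open>2 * b\<close> and
  \<open>2 * a + 2 * b + 4 * d\<close> have elementary symmetric functions divisible by 4, so the
  product is \<open>p ^ 4\<close> plus 4 times an integral polynomial.\<close>

lemma four_factor_expansion:
  fixes p a b d :: "'a::idom"
  shows "p * (p + 2 * a) * (p + 2 * b) * (p + 2 * a + 2 * b + 4 * d) =
    p ^ 4 + 4 * (p ^ 3 * (a + b + d) + p\<^sup>2 * (a * a + 3 * a * b + b * b) +
      2 * p\<^sup>2 * d * (a + b) + 2 * p * a * b * (a + b + 2 * d))"
  by algebra

text \<open>
  With \<open>x\<^sub>i\<^sub>j\<close> the coefficients of \<open>u\<^sup>i v\<^sup>j\<close>, the first four factors are the character values of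
  \<open>\<Sum> x\<^sub>i\<^sub>j u\<^sup>i v\<^sup>j\<close> for \<open>p = \<Sum> x\<^sub>i\<^sub>j\<close>, \<open>a = - x\<^sub>1\<^sub>0 - x\<^sub>1\<^sub>1\<close>, \<open>b = - x\<^sub>0\<^sub>1 - x\<^sub>1\<^sub>1\<close>, \<open>d = x\<^sub>1\<^sub>1\<close>. The primed ones
  belong to \<open>w = - 1\<close>, the others to \<open>w = 1\<close>.
\<close>

lemma eight_factors_cong:
  fixes p a b d p' a' b' d' :: complex
  assumes O: "p \<in> eisenstein_ints" "a \<in> eisenstein_ints" "b \<in> eisenstein_ints" "d \<in> eisenstein_ints"
      "p' \<in> eisenstein_ints" "a' \<in> eisenstein_ints" "b' \<in> eisenstein_ints" "d' \<in> eisenstein_ints"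
    and c: "eis_cong 2 p' p" "eis_cong 2 a' a" "eis_cong 2 b' b" "eis_cong 2 d' d"
  shows "eis_cong 8 (p * (p + 2 * a) * (p + 2 * b) * (p + 2 * a + 2 * b + 4 * d) *
    (p' * (p' + 2 * a') * (p' + 2 * b') * (p' + 2 * a' + 2 * b' + 4 * d'))) (p ^ 8)"
proof -
  define R :: "complex \<Rightarrow> complex \<Rightarrow> complex \<Rightarrow> complex \<Rightarrow> complex" where
    "R p a b d = p ^ 3 * (a + b + d) + p\<^sup>2 * (a * a + 3 * a * b + b * b) +
      2 * p\<^sup>2 * d * (a + b) + 2 * p * a * b * (a + b + 2 * d)" for p a b d
  have RO: "R p a b d \<in> eisenstein_ints"
    unfolding R_def by (simp add: O)
  \<comment> \<open>\<open>R\<close> has integer coefficients, so it respects congruence modulo 2.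
    Hence the two remainders add up to an even element, which turns the factor 4 into 8.\<close>
  have "eis_cong 2 (R p' a' b' d') (R p a b d)"
    unfolding R_def by (intro eis_cong_add eis_cong_mult eis_cong_power eis_cong_refl c) (simp_all add: O)
  then obtain v where v: "v \<in> eisenstein_ints" "R p' a' b' d' = R p a b d + 2 * v"
    by (rule eis_congE)
  obtain c where c: "c \<in> eisenstein_ints" "p' = p + 2 * c"
    using c(1) by (rule eis_congE)
  \<comment> \<open>One eighth of the binomial expansion of
    \<open>(p + 2 * c) ^ 4 - p ^ 4\<close>.\<close>
  define w where "w = p ^ 3 * c + 3 * p\<^sup>2 * c\<^sup>2 + 4 * p * c ^ 3 + 2 * c ^ 4"
  have w: "p' ^ 4 = p ^ 4 + 8 * w"
    unfolding c(2) w_def by (simp add: algebra_simps power2_eq_square power3_eq_cube power4_eq_xxxx)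
  have wO: "w \<in> eisenstein_ints"
    unfolding w_def by (simp add: O c)
  let ?R = "R p a b d"
  show ?thesis
    unfolding four_factor_expansion R_def[symmetric] v(2) w
  proof (rule eis_congI)
    have 8: "p ^ 8 = (p ^ 4)\<^sup>2"
      by simp
    show "(p ^ 4 + 4 * ?R) * (p ^ 4 + 8 * w + 4 * (?R + 2 * v)) =
      p ^ 8 + 8 * (p ^ 4 * (w + ?R + v) + 2 * ?R\<^sup>2 + 4 * ?R * (w + v))"
      unfolding 8 by algebra
    show "p ^ 4 * (w + ?R + v) + 2 * ?R\<^sup>2 + 4 * ?R * (w + v) \<in> eisenstein_ints"
      by (simp add: O RO wO v(1))
  qed
qed

text \<open>The first squaring lifts the congruence from modulus 2 to 4, the second from 4 to 8; the
  third keeps modulus 8.\<close>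

lemma eis_cong_2_power_8:
  assumes "eis_cong 2 x y" "y \<in> eisenstein_ints"
  shows "eis_cong 8 (x ^ 8) (y ^ 8)"
proof -
  obtain t where t: "t \<in> eisenstein_ints" "x = y + 2 * t"
    using assms(1) by (rule eis_congE)
  define s where "s = y * t + t\<^sup>2"
  have "x\<^sup>2 = y\<^sup>2 + 4 * s"
    by (simp add: t(2) s_def power2_eq_square algebra_simps)
  then have "(x\<^sup>2)\<^sup>2 = (y\<^sup>2)\<^sup>2 + 8 * (y\<^sup>2 * s + 2 * s\<^sup>2)"
    by (simp add: power2_eq_square algebra_simps)
  then have 4: "eis_cong 8 (x ^ 4) (y ^ 4)"
    using assms t(1) by (intro eis_congI[where c = "y\<^sup>2 * s + 2 * s\<^sup>2"]) (simp_all add: s_def)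
  have "eis_cong 8 ((x ^ 4) ^ 2) ((y ^ 4) ^ 2)"
    using assms t by (intro eis_cong_power[OF 4]) simp_all
  then show ?thesis by (simp flip: power_mult)
qed

text \<open>O/2O is the field with four elements, whose units are the classes of 1, \<omega> and
  \<omega>^2 = -1 - \<omega>. The four parity patterns of the coordinates are its four
  classes.\<close>

lemma eis_cong_2_omega_power:
  assumes "x \<in> eisenstein_ints" "\<not> eis_cong 2 x 0"
  obtains j where "eis_cong 2 x (eis_omega ^ j)"
proof -
  obtain b c where x: "x = of_int b + of_int c * eis_omega"
    using assms(1) by (rule eis_intsE)
  have E: "eis_cong 2 x (of_int b' + of_int c' * eis_omega)" if e: "even (b - b')" "even (c - c')" for b' c'
  proof -
    obtain k where "b - b' = 2 * k"
      using e(1) by (rule dvdE)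
    moreover obtain l where "c - c' = 2 * l"
      using e(2) by (rule dvdE)
    ultimately have "b = b' + 2 * k" "c = c' + 2 * l"
      by linarith+
    then have "x = of_int b' + of_int c' * eis_omega + 2 * (of_int k + of_int l * eis_omega)"
      by (simp add: x algebra_simps)
    then show ?thesis
      using eis_congI eis_intsI by blast
  qed
  consider "even b" "even c" | "odd b" "even c" | "even b" "odd c" | "odd b" "odd c"
    by blast
  then show thesis
  proof cases
    case 1
    then show thesis using E[of 0 0] assms(2) by simp
  next
    case 2
    then show thesis using E[of 1 0] that[of 0] by simp
  next
    case 3
    then show thesis using E[of 0 1] that[of 1] by simp
  next
    case 4
    then show thesis using E[of "- 1" "- 1"] that[of 2] by (simp add: omega_sq)
  qed
qed

lemma eis_norm_cong_1:
  assumes "eis_cong 8 x 1"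
  shows "[eis_norm x = 1] (mod 8)"
proof -
  obtain b c where "x = 1 + 8 * (of_int b + of_int c * eis_omega)"
    using assms by (metis eis_congE eis_intsE)
  then have x: "x = of_int (1 + 8 * b) + of_int (8 * c) * eis_omega"
    by (simp add: algebra_simps)
  have "eis_norm x = 1 + 8 * (2 * b + 8 * b\<^sup>2 - c - 8 * b * c + 8 * c\<^sup>2)"
    unfolding x eis_norm_eq by (simp add: power2_eq_square algebra_simps)
  then show ?thesis
    by (simp add: cong_iff_dvd_diff)
qed

lemma eis_norm_even:
  assumes "eis_cong 2 x 0"
  shows "even (eis_norm x)"
proof -
  obtain b c where "x = 2 * (of_int b + of_int c * eis_omega)"
    using assms by (metis eis_congE eis_intsE add_0)
  then have x: "x = of_int (2 * b) + of_int (2 * c) * eis_omega"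
    by (simp add: algebra_simps)
  show ?thesis
    unfolding x eis_norm_eq by simp
qed

lemma odd_power_8_cong:
  fixes c :: int
  assumes "odd c"
  shows "[c ^ 8 = 1] (mod 8)"
proof -
  have "[c\<^sup>2 = 1] (mod 8)"
  proof -
    obtain k where "c = 2 * k + 1"
      using assms by (elim oddE)
    then have "c\<^sup>2 - 1 = 4 * (k * (k + 1))"
      by (simp add: power2_eq_square algebra_simps)
    moreover have "2 dvd k * (k + 1)"
      by simp
    then have "4 * 2 dvd 4 * (k * (k + 1))"
      by (rule mult_dvd_mono[OF dvd_refl])
    ultimately show ?thesis
      by (simp add: cong_iff_dvd_diff)
  qed
  then have "[(c\<^sup>2) ^ 4 = 1 ^ 4] (mod 8)"
    by (rule cong_pow)
  then show ?thesis by simp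
qed

section \<open>The character table of C_2^3 x C_3\<close>

definition chi2 :: "2 \<Rightarrow> 2 \<Rightarrow> complex"
  where "chi2 k g = (if k = 0 \<or> g = 0 then 1 else - 1)"

text \<open>\<open>\<omega>\<^bsup>k g\<^esup>\<close>: for nonzero \<open>k\<close>, \<open>g\<close> modulo 3, \<open>k g = 1\<close> if and only if \<open>k = g\<close>.\<close>

definition chi3 :: "3 \<Rightarrow> 3 \<Rightarrow> complex"
  where "chi3 k g = (if k = 0 \<or> g = 0 then 1 else if k = g then eis_omega else eis_omega\<^sup>2)"

text \<open>Characters are indexed by the group itself, so that the character table is a square
  matrix whose determinant can be taken.\<close>

fun chi :: "C222C3 \<Rightarrow> C222C3 \<Rightarrow> complex"
  where "chi (i, j, k, m) (p, q, r, n) = chi2 i p * chi2 j q * chi2 k r * chi3 m n"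

lemma UNIV_2_eq: "(UNIV :: 2 set) = {0, 1}"
  using UNIV_2 by auto

lemma UNIV_3_eq: "(UNIV :: 3 set) = {0, 1, 2}"
  using UNIV_3 by auto

lemma cases_2: obtains "x = 0" | "x = (1::2)"
  using UNIV_2_eq by blast

lemma cases_3: obtains "x = 0" | "x = 1" | "x = (2::3)"
  using UNIV_3_eq by blast

lemma chi2_add: "chi2 k (g + h) = chi2 k g * chi2 k h"
  by (cases k rule: cases_2; cases g rule: cases_2; cases h rule: cases_2) (simp_all add: chi2_def)

lemma chi3_add: "chi3 k (g + h) = chi3 k g * chi3 k h"
  by (cases k rule: cases_3; cases g rule: cases_3; cases h rule: cases_3)
    (simp_all add: chi3_def omega_simps)

lemma chi_add: "chi k (g + h) = chi k g * chi k h"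
  by (cases k; cases g; cases h) (simp add: chi2_add chi3_add)

lemma chi_0: "chi k 0 = 1"
  by (cases k) (simp add: zero_prod_def chi2_def chi3_def)

lemma sum_UNIV_2: "sum f (UNIV :: 2 set) = f 0 + f 1"
  unfolding UNIV_2_eq by simp

lemma sum_UNIV_3: "sum f (UNIV :: 3 set) = f 0 + (f 1 + f 2)"
  unfolding UNIV_3_eq by simp

lemma prod_UNIV_2: "prod f (UNIV :: 2 set) = f 0 * f 1"
  unfolding UNIV_2_eq by simp

text \<open>The bracketing keeps the two nontrivial characters of C_3 together: their values are
  conjugate and multiply to a norm.\<close>

lemma prod_UNIV_3: "prod f (UNIV :: 3 set) = f 0 * (f 1 * f 2)"
  unfolding UNIV_3_eq by simp

lemma sum_chi2: "(\<Sum>g\<in>UNIV. chi2 k g * chi2 l g) = (if k = l then 2 else 0)"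
  unfolding sum_UNIV_2 by (cases k rule: cases_2; cases l rule: cases_2) (simp_all add: chi2_def)

lemma sum_chi3: "(\<Sum>g\<in>UNIV. chi3 k g * cnj (chi3 l g)) = (if k = l then 3 else 0)"
  unfolding sum_UNIV_3
  by (cases k rule: cases_3; cases l rule: cases_3)
    (simp_all add: chi3_def omega_simps, simp_all add: omega_sq)

lemma sum_C222C3: "sum f (UNIV :: C222C3 set) =
  (\<Sum>i\<in>UNIV. \<Sum>j\<in>UNIV. \<Sum>k\<in>UNIV. \<Sum>m\<in>UNIV. f (i, j, k, m))"
  by (simp only: UNIV_Times_UNIV[symmetric] sum.cartesian_product')

lemma prod_C222C3: "prod f (UNIV :: C222C3 set) =
  (\<Prod>i\<in>UNIV. \<Prod>j\<in>UNIV. \<Prod>k\<in>UNIV. \<Prod>m\<in>UNIV. f (i, j, k, m))"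
  by (simp only: UNIV_Times_UNIV[symmetric] prod.cartesian_product')

lemma sum_factor:
  fixes f1 :: "'i \<Rightarrow> 'a::comm_semiring_1"
  shows "(\<Sum>i\<in>A. \<Sum>j\<in>B. \<Sum>k\<in>C. \<Sum>m\<in>D. f1 i * f2 j * f3 k * f4 m) =
    sum f1 A * sum f2 B * sum f3 C * sum f4 D"
  by (simp add: sum_distrib_left[symmetric] sum_distrib_right[symmetric])

text \<open>Orthogonality of characters, obtained from the cyclic factors; 24 is the order of the
  group.\<close>

lemma sum_chi: "(\<Sum>g\<in>UNIV. chi k g * cnj (chi l g)) = (if k = l then 24 else 0)"
proof -
  obtain i j p m i' j' p' m' where kl: "k = (i, j, p, m)" "l = (i', j', p', m')"
    by (metis prod_cases4)
  have c: "cnj (chi2 x y) = chi2 x y" for x y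
    by (simp add: chi2_def)
  have "(\<Sum>g\<in>UNIV. chi k g * cnj (chi l g)) =
    (\<Sum>g\<in>UNIV. chi2 i g * chi2 i' g) * (\<Sum>g\<in>UNIV. chi2 j g * chi2 j' g) *
    (\<Sum>g\<in>UNIV. chi2 p g * chi2 p' g) * (\<Sum>g\<in>UNIV. chi3 m g * cnj (chi3 m' g))"
    unfolding sum_C222C3 sum_factor[symmetric]
    by (intro sum.cong refl) (simp add: kl c mult_ac)
  then show ?thesis
    unfolding sum_chi2 sum_chi3 by (auto simp: kl)
qed

text \<open>By orthogonality, the conjugate transpose divided by 24 is a right inverse of the
  table.\<close>

lemma det_chi: "det (\<chi> k g. chi k g) \<noteq> 0"
proof -
  let ?X = "(\<chi> k g. chi k g) :: complex^C222C3^C222C3"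
  let ?Y = "(\<chi> g k. cnj (chi k g) / 24) :: complex^C222C3^C222C3"
  have "(\<Sum>g\<in>UNIV. chi k g * (cnj (chi l g) / 24)) = (if k = l then 1 else 0)" for k l
    by (simp add: sum_divide_distrib[symmetric] sum_chi)
  then have "?X ** ?Y = mat 1"
    unfolding matrix_matrix_mult_def mat_def vec_lambda_beta by (simp only:)
  then have "det ?X * det ?Y = 1"
    by (simp only: det_mul[symmetric] det_I)
  then show ?thesis by auto
qed

lemma of_int_group_det:
  "of_int (group_det a) =
    (\<Prod>i\<in>UNIV. \<Prod>j\<in>UNIV. \<Prod>k\<in>UNIV. \<Prod>m\<in>UNIV. char_sum (chi (i, j, k, m)) a)"
  by (simp only: group_det_char[where ch = chi, OF chi_add det_chi] prod_C222C3)

section \<open>Integrality, conjugation and congruences of character values\<close>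

lemma chi2_eis [simp]: "chi2 k g \<in> eisenstein_ints"
  by (simp add: chi2_def)

lemma chi3_eis [simp]: "chi3 k g \<in> eisenstein_ints"
  by (simp add: chi3_def)

lemma chi_eis [simp]: "chi k g \<in> eisenstein_ints"
  by (cases k; cases g) simp

lemma char_sum_eis [simp]: "char_sum (chi k) a \<in> eisenstein_ints"
  by (simp add: char_sum_def)

lemma char_sum_int: "char_sum (chi (i, j, k, 0)) a \<in> \<int>"
proof -
  have "chi (i, j, k, 0) g \<in> \<int>" for g
    by (cases g) (simp add: chi2_def chi3_def)
  then show ?thesis
    unfolding char_sum_def by (intro Ints_sum Ints_mult) simp_all
qed

lemma char_sum_cnj: "char_sum (chi (i, j, k, 2)) a = cnj (char_sum (chi (i, j, k, 1)) a)"
proof -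
  have "chi3 2 n = cnj (chi3 1 n)" for n
    by (cases n rule: cases_3) (simp_all add: chi3_def omega_simps)
  then have "chi (i, j, k, 2) g = cnj (chi (i, j, k, 1) g)" for g
    by (cases g) (simp add: chi2_def)
  then show ?thesis
    by (simp add: char_sum_def)
qed

lemma omega_power_cong_1: "eis_cong eis_lambda 1 (eis_omega ^ j)"
proof -
  have "eis_cong eis_lambda 1 eis_omega"
    by (rule eis_congI[where c = 1]) (simp_all add: eis_lambda_def)
  then have "eis_cong eis_lambda (1 ^ j) (eis_omega ^ j)"
    by (rule eis_cong_power) simp_all
  then show ?thesis by simp
qed

text \<open>The two characters differ only by powers of \<omega>, and \<omega> is 1 modulo \<lambda>
  = 1 - \<omega>.\<close>

lemma char_sum_cong:
  "eis_cong eis_lambda (char_sum (chi (i, j, k, 0)) a) (char_sum (chi (i, j, k, 1)) a)"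
proof -
  have *: "eis_cong eis_lambda (chi3 0 n) (chi3 1 n)" for n
    using omega_power_cong_1[of 1] omega_power_cong_1[of 2]
    by (cases n rule: cases_3) (simp_all add: chi3_def)
  have "eis_cong eis_lambda (chi (i, j, k, 0) g) (chi (i, j, k, 1) g)" for g
    by (cases g) (simp add: * eis_cong_mult)
  then show ?thesis
    unfolding char_sum_def by (intro eis_cong_sum eis_cong_mult) simp_all
qed

lemma prod_char_sum_cong:
  "eis_cong 8 (\<Prod>i\<in>UNIV. \<Prod>j\<in>UNIV. \<Prod>k\<in>UNIV. char_sum (chi (i, j, k, m)) a)
    (char_sum (chi (0, 0, 0, m)) a ^ 8)"
proof -
  \<comment> \<open>Summing out C_3 first leaves an element of the group ring of C_2^3 over
    O.\<close>
  define y where "y p q r = (\<Sum>n\<in>UNIV. of_int (Poly_Mapping.lookup a (p, q, r, n)) * chi3 m n)" for p q r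
  have yO: "y p q r \<in> eisenstein_ints" for p q r
    unfolding y_def by simp
  have F: "char_sum (chi (i, j, k, m)) a =
    (\<Sum>p\<in>UNIV. \<Sum>q\<in>UNIV. \<Sum>r\<in>UNIV. chi2 i p * chi2 j q * chi2 k r * y p q r)" for i j k
    unfolding char_sum_def sum_C222C3 y_def sum_distrib_left by (simp add: mult_ac)
  \<comment> \<open>\<open>s\<close> and \<open>d\<close> are the images under w = 1 and w = -1.
    They agree modulo 2, as \<open>eight_factors_cong\<close> demands.\<close>
  define s where "s p q = y p q 0 + y p q 1" for p q
  define d where "d p q = y p q 0 - y p q 1" for p q
  have sd: "s p q \<in> eisenstein_ints" "d p q \<in> eisenstein_ints" for p q
    by (simp_all add: s_def d_def yO)
  have ds: "eis_cong 2 (d p q) (s p q)" for p q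
    by (rule eis_congI[where c = "- y p q 1"]) (simp_all add: s_def d_def yO)
  have ds': "eis_cong 2 (- d p q) (- s p q)" for p q
    by (rule eis_congI[where c = "y p q 1"]) (simp_all add: s_def d_def yO)
  \<comment> \<open>The product over the four characters of the group generated by u and v, in the
    shape of \<open>four_factor_expansion\<close>.\<close>
  define Q :: "(2 \<Rightarrow> 2 \<Rightarrow> complex) \<Rightarrow> complex" where
    "Q f = (let p = f 0 0 + f 0 1 + (f 1 0 + f 1 1); a = - f 1 0 + - f 1 1; b = - f 0 1 + - f 1 1 in
      p * (p + 2 * a) * (p + 2 * b) * (p + 2 * a + 2 * b + 4 * f 1 1))" for f
  have Q: "Q f = (\<Prod>i\<in>UNIV. \<Prod>j\<in>UNIV. \<Sum>p\<in>UNIV. \<Sum>q\<in>UNIV. chi2 i p * chi2 j q * f p q)" for f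
  proof -
    have "Q f = (f 0 0 + f 0 1 + f 1 0 + f 1 1) * (f 0 0 - f 0 1 + f 1 0 - f 1 1) *
        ((f 0 0 + f 0 1 - f 1 0 - f 1 1) * (f 0 0 - f 0 1 - f 1 0 + f 1 1))"
      unfolding Q_def Let_def by (simp add: algebra_simps)
    then show ?thesis
      unfolding prod_UNIV_2 sum_UNIV_2 by (simp add: chi2_def algebra_simps)
  qed
  have s: "char_sum (chi (i, j, 0, m)) a = (\<Sum>p\<in>UNIV. \<Sum>q\<in>UNIV. chi2 i p * chi2 j q * s p q)"
    and d: "char_sum (chi (i, j, 1, m)) a = (\<Sum>p\<in>UNIV. \<Sum>q\<in>UNIV. chi2 i p * chi2 j q * d p q)" for i j
    unfolding F s_def d_def sum_UNIV_2[of "\<lambda>r. _ r * y _ _ r"]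
    by (simp_all add: chi2_def algebra_simps)
  have "(\<Prod>i\<in>UNIV. \<Prod>j\<in>UNIV. \<Prod>k\<in>UNIV. char_sum (chi (i, j, k, m)) a) = Q s * Q d"
    unfolding prod_UNIV_2[of "\<lambda>k. char_sum (chi (_, _, k, m)) a"] Q s d by (simp only: prod.distrib)
  moreover have "char_sum (chi (0, 0, 0, m)) a = s 0 0 + s 0 1 + (s 1 0 + s 1 1)"
    unfolding s sum_UNIV_2 by (simp add: chi2_def)
  moreover have "eis_cong 8 (Q s * Q d) ((s 0 0 + s 0 1 + (s 1 0 + s 1 1)) ^ 8)"
    unfolding Q_def Let_def
    by (rule eight_factors_cong) (intro eis_cong_add ds ds' | simp add: sd)+
  ultimately show ?thesis by simp
qed

section \<open>Necessity of the conditions\<close>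

lemma group_det_necessary:
  fixes a :: "C222C3 \<Rightarrow>\<^sub>0 int"
  assumes "odd (group_det a)"
  shows "[group_det a = 1] (mod 8) \<and> cond_T (group_det a)"
proof -
  \<comment> \<open>\<open>P 0\<close> is the integer factor; \<open>P 1\<close> and
    \<open>P 2\<close> are conjugate and contribute the norm.\<close>
  define P where "P m = (\<Prod>i\<in>UNIV. \<Prod>j\<in>UNIV. \<Prod>k\<in>UNIV. char_sum (chi (i, j, k, m)) a)" for m
  let ?c = "\<lambda>m. char_sum (chi (0, 0, 0, m)) a"
  have PO: "P m \<in> eisenstein_ints" for m
    unfolding P_def by (intro eis_ints_prod) simp
  have P8: "eis_cong 8 (P m) (?c m ^ 8)" for m
    unfolding P_def by (rule prod_char_sum_cong)
  have "P 0 \<in> \<int>"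
    unfolding P_def by (intro Ints_prod char_sum_int)
  then obtain A where A: "P 0 = of_int A"
    by (auto elim: Ints_cases)
  have "of_int (group_det a) = P 0 * (P 1 * P 2)"
    unfolding of_int_group_det prod_UNIV_3 prod.distrib P_def ..
  moreover have "P 2 = cnj (P 1)"
    unfolding P_def char_sum_cnj by simp
  ultimately have "(of_int (group_det a) :: complex) = of_int (A * eis_norm (P 1))"
    by (simp add: A eis_norm_eq_mult_cnj PO)
  then have D: "group_det a = A * eis_norm (P 1)"
    by (simp only: of_int_eq_iff)
  then have odd: "odd A" "odd (eis_norm (P 1))"
    using assms by simp_all

  obtain c where c: "?c 0 = of_int c"
    using char_sum_int by (rule Ints_cases)
  have "eis_cong (of_int 8) (of_int A) (of_int (c ^ 8))"
    using P8[of 0] by (simp add: A c)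
  then have Ac: "[A = c ^ 8] (mod 8)"
    by (rule eis_cong_of_int)
  then have "even A \<longleftrightarrow> even (c ^ 8)"
    by (metis cong_dvd_iff cong_dvd_modulus even_numeral)
  with odd have "odd c"
    by simp
  with Ac have A1: "[A = 1] (mod 8)"
    using cong_trans odd_power_8_cong by blast

  \<comment> \<open>Otherwise \<open>P 1\<close>, congruent to \<open>?c 1 ^ 8\<close> modulo 8,
    would be divisible by 2 and have even norm.\<close>
  have "\<not> eis_cong 2 (?c 1) 0"
  proof
    assume "eis_cong 2 (?c 1) 0"
    then have "eis_cong 2 (?c 1 ^ 8) (0 ^ 8)"
      by (rule eis_cong_power) simp_all
    moreover have "eis_cong 2 (P 1) (?c 1 ^ 8)"
    proof -
      obtain x where "x \<in> eisenstein_ints" "P 1 = ?c 1 ^ 8 + 8 * x"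
        using P8 by (rule eis_congE)
      then show ?thesis
        by (intro eis_congI[where c = "4 * x"]) simp_all
    qed
    ultimately have "eis_cong 2 (P 1) 0"
      using eis_cong_trans by fastforce
    with odd(2) show False
      using eis_norm_even by blast
  qed
  then obtain j where "eis_cong 2 (?c 1) (eis_omega ^ j)"
    using eis_cong_2_omega_power[OF char_sum_eis] by blast
  then have "eis_cong 8 (?c 1 ^ 8) ((eis_omega ^ j) ^ 8)"
    by (rule eis_cong_2_power_8) simp
  with P8 have P1: "eis_cong 8 (P 1) ((eis_omega ^ j) ^ 8)"
    by (rule eis_cong_trans)
  \<comment> \<open>The twist cancels the eighth power, since \<omega>^(8j) \<omega>^j =
    (\<omega>^9)^j = 1. As \<omega> has norm 1 and is 1 modulo \<lambda>, neither the norm nor the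
    residue modulo \<lambda> changes.\<close>
  define \<beta> where "\<beta> = P 1 * eis_omega ^ j"
  have \<beta>O: "\<beta> \<in> eisenstein_ints"
    unfolding \<beta>_def by (simp add: PO)
  have w3: "eis_omega ^ 3 = 1"
    using omega_cube by (simp add: power3_eq_cube power2_eq_square mult.assoc)
  have "eis_omega ^ (9 * j) = ((eis_omega ^ 3) ^ 3) ^ j"
    by (simp only: power_mult[symmetric]) simp
  then have "(eis_omega ^ j) ^ 8 * eis_omega ^ j = 1"
    by (simp add: w3 flip: power_mult power_add)
  moreover have "eis_cong 8 \<beta> ((eis_omega ^ j) ^ 8 * eis_omega ^ j)"
    unfolding \<beta>_def by (rule eis_cong_mult[OF P1]) (simp_all add: PO)
  ultimately have \<beta>1: "eis_cong 8 \<beta> 1"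
    by simp
  have "eis_omega * cnj eis_omega = 1"
    by (simp add: cnj_omega omega_cube)
  then have "\<beta> * cnj \<beta> = P 1 * cnj (P 1)"
    by (simp add: \<beta>_def power_mult_distrib[symmetric] mult_ac)
  then have "(of_int (eis_norm \<beta>) :: complex) = of_int (eis_norm (P 1))"
    by (simp add: eis_norm_eq_mult_cnj PO \<beta>O)
  then have N: "eis_norm \<beta> = eis_norm (P 1)"
    by (simp only: of_int_eq_iff)
  have "eis_cong eis_lambda (P 0) (P 1)"
    unfolding P_def by (intro eis_cong_prod char_sum_cong eis_ints_prod) simp_all
  then have "eis_cong eis_lambda (P 0 * 1) (P 1 * eis_omega ^ j)"
    by (rule eis_cong_mult[OF _ omega_power_cong_1]) (simp_all add: PO)
  then have "eis_cong eis_lambda (of_int A) \<beta>"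
    by (simp add: A \<beta>_def)
  then have "cond_T (group_det a)"
    unfolding cond_T_def D N[symmetric] using odd \<beta>O \<beta>1 by blast
  moreover have "[group_det a = 1 * 1] (mod 8)"
    unfolding D N[symmetric] by (rule cong_mult[OF A1 eis_norm_cong_1[OF \<beta>1]])
  ultimately show ?thesis by simp
qed

section \<open>The special family and sufficiency\<close>

text \<open>The product of the three factors 1 + u, 1 + v, 1 + w takes the value 8 at characters
  trivial on C_2^3 and 0 at all others, so 21 of the 24 values equal 1.\<close>

lemma of_int_group_det_family:
  fixes r s t :: int
  defines "F \<equiv> \<lambda>x :: complex. 1 + 8 * (of_int r + of_int s * x + of_int t * x\<^sup>2)"
  shows "of_int (group_det
        (1 + (1 + gen_u) * (1 + gen_v) * (1 + gen_w) *
          (of_int r + of_int s * gen_z + of_int t * gen_z\<^sup>2))) =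
    F 1 * (F eis_omega * F (eis_omega\<^sup>2))"
proof -
  have g: "char_sum (chi (i, j, k, m)) gen_u = chi2 i 1" "char_sum (chi (i, j, k, m)) gen_v = chi2 j 1"
    "char_sum (chi (i, j, k, m)) gen_w = chi2 k 1" "char_sum (chi (i, j, k, m)) gen_z = chi3 m 1" for i j k m
    by (simp_all add: gen_u_def gen_v_def gen_w_def gen_z_def char_sum_single chi2_def chi3_def)
  have "char_sum (chi (i, j, k, m))
      (1 + (1 + gen_u) * (1 + gen_v) * (1 + gen_w) *
          (of_int r + of_int s * gen_z + of_int t * gen_z\<^sup>2)) =
      1 + (1 + chi2 i 1) * (1 + chi2 j 1) * (1 + chi2 k 1) *
        (of_int r + of_int s * chi3 m 1 + of_int t * (chi3 m 1)\<^sup>2)" for i j k m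
    by (simp only: power2_eq_square char_sum_add char_sum_mult[where ch = "chi k" for k, OF chi_add] char_sum_of_int[where ch = "chi k" for k, OF chi_0] g)
  then show ?thesis
    unfolding of_int_group_det prod_UNIV_2 prod_UNIV_3
    by (simp add: chi2_def chi3_def F_def)
qed

lemma group_det_sufficient:
  assumes "[D = 1] (mod 8)" "cond_T D"
  shows "\<exists>r s t :: int. D = group_det
        (1 + (1 + gen_u) * (1 + gen_v) * (1 + gen_w) *
          (of_int r + of_int s * gen_z + of_int t * gen_z\<^sup>2))"
proof -
  obtain A \<beta> where \<beta>: "\<beta> \<in> eisenstein_ints" and D: "D = A * eis_norm \<beta>"
    and 8: "eis_cong 8 \<beta> 1" and l: "eis_cong eis_lambda (of_int A) \<beta>"
    using assms(2) by (auto simp: cond_T_def)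
  \<comment> \<open>The norm of \<beta> is 1 modulo 8, so \<open>A\<close> inherits the residue of
    \<open>D\<close>.\<close>
  have "[A * eis_norm \<beta> = A * 1] (mod 8)"
    by (intro cong_mult cong_refl eis_norm_cong_1 8)
  then have "[A = 1] (mod 8)"
    using assms(1) by (simp add: D cong_def)
  then obtain m where m: "A = 1 + 8 * m"
    by (metis cong_iff_lin cong_sym)
  obtain b c where bc: "\<beta> = 1 + 8 * (of_int b + of_int c * eis_omega)"
    using 8 by (metis eis_congE eis_intsE)
  obtain x y where "of_int A = \<beta> + eis_lambda * (of_int x + of_int y * eis_omega)"
    using l by (metis eis_congE eis_intsE)
  also have "eis_lambda * (of_int x + of_int y * eis_omega) =
      of_int (x + y) + of_int (2 * y - x) * eis_omega"
    using eis_mult_coords[of 1 "- 1" x y] by (simp add: eis_lambda_def)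
  finally have "of_int (8 * m) + of_int 0 * eis_omega =
      of_int (8 * b + x + y) + of_int (8 * c + 2 * y - x) * eis_omega"
    by (simp add: m bc algebra_simps)
  then have "8 * m = 8 * b + x + y" "0 = 8 * c + 2 * y - x"
    by (rule eis_coords_unique)+
  \<comment> \<open>Eliminating \<open>x\<close> gives \<open>8 * (m - b - c) = 3 * y\<close>, and 8
    is prime to 3.\<close>
  then have "3 dvd m - b - c"
    by presburger
  then obtain t where t: "m - b - c = 3 * t"
    by (rule dvdE)
  \<comment> \<open>Since \<omega>^2 = -1 - \<omega>, matching \<beta> forces
    \<open>r - t = b\<close> and \<open>s - t = c\<close>; then
    \<open>r + s + t = b + c + 3 * t\<close>, which is \<open>m\<close> by the choice of
    \<open>t\<close>.\<close>
  define r s where "r = b + t" and "s = c + t"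
  have F: "1 + 8 * (of_int r + of_int s * eis_omega + of_int t * eis_omega\<^sup>2) = \<beta>"
    by (simp add: bc r_def s_def omega_sq algebra_simps)
  have "1 + 8 * (of_int r + of_int s * eis_omega\<^sup>2 + of_int t * (eis_omega\<^sup>2)\<^sup>2) = cnj \<beta>"
    unfolding F[symmetric] by (simp add: cnj_omega)
  moreover have "m = r + s + t"
    using t by (simp add: r_def s_def)
  then have "(1 + 8 * (of_int r + of_int s * 1 + of_int t * 1\<^sup>2) :: complex) = of_int A"
    by (simp add: m)
  ultimately have "of_int (group_det
        (1 + (1 + gen_u) * (1 + gen_v) * (1 + gen_w) *
          (of_int r + of_int s * gen_z + of_int t * gen_z\<^sup>2))) = (of_int D :: complex)"
    unfolding of_int_group_det_family F D by (simp add: eis_norm_eq_mult_cnj \<beta>)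
  then show ?thesis
    by (metis of_int_eq_iff)
qed

theorem proposition5p2:
  fixes D :: int
  assumes "odd D"
  shows "(D \<in> group_dets TYPE(C222C3) \<longleftrightarrow> [D = 1] (mod 8) \<and> cond_T D) \<and>
    (D \<in> group_dets TYPE(C222C3) \<longrightarrow>
      (\<exists>r s t :: int. D = group_det
        (1 + (1 + gen_u) * (1 + gen_v) * (1 + gen_w) *
          (of_int r + of_int s * gen_z + of_int t * gen_z\<^sup>2))))"
proof -
  have "[D = 1] (mod 8) \<and> cond_T D" if "D \<in> group_dets TYPE(C222C3)"
    using that assms group_det_necessary by (auto simp: group_dets_def)
  moreover have "D \<in> group_dets TYPE(C222C3)" if "[D = 1] (mod 8)" "cond_T D"
    using group_det_sufficient[OF that] by (auto simp: group_dets_def)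
  ultimately show ?thesis
    using group_det_sufficient by blast
qed

end
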